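(* Consider the nonlinear vector Riemannian conjugate gradient method described in the context. Assume that for each $k\ge 1$, $0\le\beta_k\le\beta_k^{\mathrm{DY}}$, where $$\beta_k^{\mathrm{DY}}=\frac{-\psi_{x_k,v_k}(0)}{\psi_{x_{k-1},d_{k-1}}(t_{k-1}d_{k-1})-\psi_{x_{k-1},d_{k-1}}(0)},$$ and that each $t_k$ satisfies the Wolfe conditions $$F(R_{x_k}(t_kd_k))\preceq_K F(x_k)+c_1t_k\,\varphi(\mathrm DF(x_k)[d_k])\,e,\qquad \psi_{x_k,d_k}(t_kd_k)\ge c_2\,\psi_{x_k,d_k}(0).$$ If $v(x_k)\ne 0$ for each $k\ge 0$, then the algorithm is well defined (i.e. for every $k\ge 1$ the denominator in $\beta_k^{\mathrm{DY}}$ is nonzero), and the following two inequalities hold for every $k\ge 0$: $$\psi_{x_k,d_k}(0)\le 0,\qquad \psi_{x_k,d_k}(0)\le\psi_{x_k,d_k}(t_kd_k).$$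
   Context: $K\subset\mathbb R^m$ is a closed, convex, pointed ($K\cap(-K)=\{0\}$) cone with nonempty interior; $u\preceq_K v$ means $v-u\in K$. $K^*=\{\omega\in\mathbb R^m\mid \omega^Ty\ge 0\ \text{for all } y\in K\}$, and $C\subset K^*\setminus\{0\}$ is a compact set such that $K^*$ is the cone generated by the convex hull of $C$. $\varphi:\mathbb R^m\to\mathbb R$ is $\varphi(y)=\sup\{y^Tw\mid w\in C\}$. $e\in K$ is a fixed vector with $0<\langle\omega,e\rangle\le 1$ for all $\omega\in C$, and $0<c_1<c_2<1$ are fixed constants. $\mathcal M$ is an $n$-dimensional smooth Riemannian manifold; $\|\cdot\|$ is the norm induced by the metric on tangent spaces. $F:\mathcal M\to\mathbb R^m$ is continuously differentiable with derivative $\mathrm DF(x):T_x\mathcal M\to\mathbb R^m$. $R:T\mathcal M\to\mathcal M$ is a retraction, i.e. a smooth map whose restrictions $R_x$ to $T_x\mathcal M$ satisfy $R_x(0_x)=x$ and $\mathrm DR_x(0_x)=\mathrm{id}_{T_x\mathcal M}$. For $x\in\mathcal M$, $v(x)$ is the unique minimizer over $d\in T_x\mathcal M$ of $\varphi(\mathrm DF(x)[d])+\|d\|^2/2$; $v_k:=v(x_k)$. For $x\in\mathcal M$, $d\in T_x\mathcal M$, $t\ge 0$, put $\psi_{x,d}(td):=\varphi\big(\mathrm DF(R_x(td))[\mathrm DR_x(td)[d]]\big)$, so $\psi_{x,d}(0)=\varphi(\mathrm DF(x)[d])$. The nonlinear vector Riemannian conjugate gradient method: start from $x_0\in\mathcal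 M$; at iteration $k$ stop if $v(x_k)=0$; otherwise set $d_0=v(x_0)$ and, for $k\ge 1$, $d_k=v(x_k)+\beta_k\mathcal T^{k-1}(d_{k-1})$, where $\beta_k\in\mathbb R$ is an algorithmic parameter and $\mathcal T^{k-1}(d_{k-1}):=\mathrm DR_{x_{k-1}}(t_{k-1}d_{k-1})[d_{k-1}]\in T_{x_k}\mathcal M$; choose a step size $t_k>0$ and set $x_{k+1}=R_{x_k}(t_kd_k)$. *)

theory Defs
  imports "HOL-Analysis.Analysis"
begin

section \<open>Smooth manifolds given by an atlas\<close>

text \<open>A chart is a pair of its domain and its coordinate map; values of the coordinate map outside
  the domain are irrelevant. The model space is any Euclidean space, so that the same notions
  apply to a manifold, to its tangent bundle, and to finite-dimensional vector spaces.\<close>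

type_synonym ('p, 'e) chart = "'p set \<times> ('p \<Rightarrow> 'e)"

primrec Ck_on :: "nat \<Rightarrow> ('a::euclidean_space \<Rightarrow> 'b::real_normed_vector) \<Rightarrow> 'a set \<Rightarrow> bool" where
  "Ck_on 0 f S \<longleftrightarrow> continuous_on S f"
| "Ck_on (Suc k) f S \<longleftrightarrow>
     (\<forall>x\<in>S. f differentiable (at x)) \<and> (\<forall>v. Ck_on k (\<lambda>x. frechet_derivative f (at x) v) S)"

text \<open>Only used for open sets. As the domain is finite-dimensional, continuity of all
  directional derivatives is continuity of the derivative.\<close>

definition smooth_on :: "('a::euclidean_space \<Rightarrow> 'b::real_normed_vector) \<Rightarrow> 'a set \<Rightarrow> bool" where
  "smooth_on f S \<longleftrightarrow> (\<forall>k. Ck_on k f S)"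

definition chart_inv :: "('p, 'e) chart \<Rightarrow> 'e \<Rightarrow> 'p" where
  "chart_inv c = inv_into (fst c) (snd c)"

definition manifold_carrier :: "('p, 'e) chart set \<Rightarrow> 'p set" where
  "manifold_carrier A = (\<Union>c\<in>A. fst c)"

definition charts_at :: "('p, 'e) chart set \<Rightarrow> 'p \<Rightarrow> ('p, 'e) chart set" where
  "charts_at A p = {c \<in> A. p \<in> fst c}"

definition smooth_atlas :: "('p, 'e::euclidean_space) chart set \<Rightarrow> bool" where
  "smooth_atlas A \<longleftrightarrow>
     (\<forall>c\<in>A. inj_on (snd c) (fst c) \<and> open (snd c ` fst c)) \<and>
     (\<forall>c\<in>A. \<forall>c'\<in>A. open (snd c ` (fst c \<inter> fst c')) \<and>
        smooth_on (snd c' \<circ> chart_inv c) (snd c ` (fst c \<inter> fst c')))"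

text \<open>The topology for which the charts are homeomorphisms from open sets onto open sets.\<close>

definition manifold_topology :: "('p, 'e::euclidean_space) chart set \<Rightarrow> 'p topology" where
  "manifold_topology A =
     topology (\<lambda>V. V \<subseteq> manifold_carrier A \<and> (\<forall>c\<in>A. open (snd c ` (V \<inter> fst c))))"

lemma openin_manifold_topology:
  assumes "\<And>c. c \<in> A \<Longrightarrow> inj_on (snd c) (fst c)"
  shows "openin (manifold_topology A) V \<longleftrightarrow>
    V \<subseteq> manifold_carrier A \<and> (\<forall>c\<in>A. open (snd c ` (V \<inter> fst c)))"
proof -
  have "istopology (\<lambda>V. V \<subseteq> manifold_carrier A \<and> (\<forall>c\<in>A. open (snd c ` (V \<inter> fst c))))"
    unfolding istopology_def
  proof (intro conjI allI impI ballI)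
    fix S T and c :: "('a, 'b) chart"
    assume S: "S \<subseteq> manifold_carrier A \<and> (\<forall>c\<in>A. open (snd c ` (S \<inter> fst c)))"
      and T: "T \<subseteq> manifold_carrier A \<and> (\<forall>c\<in>A. open (snd c ` (T \<inter> fst c)))" and c: "c \<in> A"
    have "snd c ` (S \<inter> T \<inter> fst c) = snd c ` (S \<inter> fst c) \<inter> snd c ` (T \<inter> fst c)"
      using assms[OF c] by (auto simp: inj_on_def)
    with S T c show "open (snd c ` (S \<inter> T \<inter> fst c))" by auto
  next
    fix \<K> and c :: "('a, 'b) chart"
    assume K: "\<forall>S\<in>\<K>. S \<subseteq> manifold_carrier A \<and> (\<forall>c\<in>A. open (snd c ` (S \<inter> fst c)))" and c: "c \<in> A"
    have "snd c ` (\<Union> \<K> \<inter> fst c) = (\<Union>S\<in>\<K>. snd c ` (S \<inter> fst c))" by auto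
    with K c show "open (snd c ` (\<Union> \<K> \<inter> fst c))" by auto
  qed blast+
  then show ?thesis
    by (simp add: manifold_topology_def topology_inverse')
qed

definition smooth_manifold :: "('p, 'e::euclidean_space) chart set \<Rightarrow> bool" where
  "smooth_manifold A \<longleftrightarrow> smooth_atlas A \<and>
     Hausdorff_space (manifold_topology A) \<and> second_countable (manifold_topology A)"

definition Ck_map :: "nat \<Rightarrow> ('p, 'e::euclidean_space) chart set \<Rightarrow>
    ('q, 'f::euclidean_space) chart set \<Rightarrow> ('p \<Rightarrow> 'q) \<Rightarrow> bool" where
  "Ck_map k A B f \<longleftrightarrow> continuous_map (manifold_topology A) (manifold_topology B) f \<and>
     (\<forall>c\<in>A. \<forall>c'\<in>B. Ck_on k (snd c' \<circ> f \<circ> chart_inv c) (snd c ` (fst c \<inter> f -` fst c')))"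

definition smooth_map :: "('p, 'e::euclidean_space) chart set \<Rightarrow>
    ('q, 'f::euclidean_space) chart set \<Rightarrow> ('p \<Rightarrow> 'q) \<Rightarrow> bool" where
  "smooth_map A B f \<longleftrightarrow> (\<forall>k. Ck_map k A B f)"

section \<open>Tangent vectors and differentials\<close>

text \<open>A tangent vector at p is the family of its coordinates in all charts around p; the
  coordinates in two charts are related by the derivative of the change of coordinates. Outside
  the charts around p the family is 0. The vector space operations are pointwise.\<close>

type_synonym ('p, 'e) tangent = "('p, 'e) chart \<Rightarrow> 'e"

definition tangent_space ::
    "('p, 'e::euclidean_space) chart set \<Rightarrow> 'p \<Rightarrow> ('p, 'e) tangent set" where
  "tangent_space A p = {v.
     (\<forall>c. c \<notin> charts_at A p \<longrightarrow> v c = 0) \<and>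
     (\<forall>c\<in>charts_at A p. \<forall>c'\<in>charts_at A p.
        v c' = frechet_derivative (snd c' \<circ> chart_inv c) (at (snd c p)) (v c))}"

definition tzero :: "('p, 'e::euclidean_space) tangent" where
  "tzero = (\<lambda>c. 0)"

definition tadd :: "('p, 'e::euclidean_space) tangent \<Rightarrow> ('p, 'e) tangent \<Rightarrow> ('p, 'e) tangent" where
  "tadd v w = (\<lambda>c. v c + w c)"

definition tscale :: "real \<Rightarrow> ('p, 'e::euclidean_space) tangent \<Rightarrow> ('p, 'e) tangent" where
  "tscale r v = (\<lambda>c. r *\<^sub>R v c)"

text \<open>The differential of f at p, computed in some chart around p (for a differentiable f the
  result does not depend on the chart).\<close>

definition differential :: "('p, 'e::euclidean_space) chart set \<Rightarrow>
    ('q, 'f::euclidean_space) chart set \<Rightarrow> ('p \<Rightarrow> 'q) \<Rightarrow> 'p \<Rightarrow> ('p, 'e) tangent \<Rightarrow> ('q, 'f) tangent" where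
  "differential A B f p v = (\<lambda>c'.
     if c' \<in> charts_at B (f p)
     then let c = (SOME c. c \<in> charts_at A p)
          in frechet_derivative (snd c' \<circ> f \<circ> chart_inv c) (at (snd c p)) (v c)
     else 0)"

definition tangent_bundle ::
    "('p, 'e::euclidean_space) chart set \<Rightarrow> ('p \<times> ('p, 'e) tangent, 'e \<times> 'e) chart set" where
  "tangent_bundle A =
     (\<lambda>c. (Sigma (fst c) (tangent_space A), \<lambda>(p, v). (snd c p, v c))) ` A"

definition euclidean_atlas :: "('b::euclidean_space, 'b) chart set" where
  "euclidean_atlas = {(UNIV, \<lambda>y. y)}"

text \<open>A tangent space is itself a manifold, with the linear coordinates induced by the charts
  around its base point.\<close>

definition tangent_space_atlas ::
    "('p, 'e::euclidean_space) chart set \<Rightarrow> 'p \<Rightarrow> (('p, 'e) tangent, 'e) chart set" where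
  "tangent_space_atlas A p = (\<lambda>c. (tangent_space A p, \<lambda>v. v c)) ` charts_at A p"

text \<open>The canonical identification of a vector space, given by an atlas L of linear charts, with
  its tangent space at p: the coordinates of h as a tangent vector are its coordinates as a vector.\<close>

definition as_tangent :: "('w, 'e::euclidean_space) chart set \<Rightarrow> 'w \<Rightarrow> 'w \<Rightarrow> ('w, 'e) tangent" where
  "as_tangent L p h = (\<lambda>c. if c \<in> charts_at L p then snd c h else 0)"

text \<open>The derivative of a map into a Euclidean space, whose tangent vectors are read off in the
  identity chart.\<close>

definition DF :: "('p, 'e::euclidean_space) chart set \<Rightarrow> ('p \<Rightarrow> 'b::euclidean_space) \<Rightarrow>
    'p \<Rightarrow> ('p, 'e) tangent \<Rightarrow> 'b" where
  "DF A F p v = differential A euclidean_atlas F p v (UNIV, \<lambda>y. y)"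

text \<open>The derivative at d, in direction h, of the restriction of R to the tangent space at p.\<close>

definition DR :: "('p, 'e::euclidean_space) chart set \<Rightarrow> ('p \<times> ('p, 'e) tangent \<Rightarrow> 'p) \<Rightarrow>
    'p \<Rightarrow> ('p, 'e) tangent \<Rightarrow> ('p, 'e) tangent \<Rightarrow> ('p, 'e) tangent" where
  "DR A R p d h = differential (tangent_space_atlas A p) A (\<lambda>w. R (p, w)) d
     (as_tangent (tangent_space_atlas A p) d h)"

definition smooth_retraction ::
    "('p, 'e::euclidean_space) chart set \<Rightarrow> ('p \<times> ('p, 'e) tangent \<Rightarrow> 'p) \<Rightarrow> bool" where
  "smooth_retraction A R \<longleftrightarrow> smooth_map (tangent_bundle A) A R \<and>
     (\<forall>p\<in>manifold_carrier A. R (p, tzero) = p \<and> (\<forall>h\<in>tangent_space A p. DR A R p tzero h = h))"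

section \<open>Riemannian metrics\<close>

definition coord_vector :: "('p, 'e::euclidean_space) chart set \<Rightarrow> ('p, 'e) chart \<Rightarrow> 'p \<Rightarrow>
    'e \<Rightarrow> ('p, 'e) tangent" where
  "coord_vector A c p a = inv_into (tangent_space A p) (\<lambda>v. v c) a"

definition riemannian_metric :: "('p, 'e::euclidean_space) chart set \<Rightarrow>
    ('p \<Rightarrow> ('p, 'e) tangent \<Rightarrow> ('p, 'e) tangent \<Rightarrow> real) \<Rightarrow> bool" where
  "riemannian_metric A g \<longleftrightarrow>
     (\<forall>p\<in>manifold_carrier A. \<forall>u\<in>tangent_space A p. \<forall>v\<in>tangent_space A p.
        g p u v = g p v u \<and>
        (\<forall>w\<in>tangent_space A p. g p (tadd u w) v = g p u v + g p w v) \<and>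
        (\<forall>r. g p (tscale r u) v = r * g p u v) \<and>
        (u \<noteq> tzero \<longrightarrow> g p u u > 0)) \<and>
     (\<forall>c\<in>A. \<forall>a b. smooth_on
        (\<lambda>y. g (chart_inv c y) (coord_vector A c (chart_inv c y) a) (coord_vector A c (chart_inv c y) b))
        (snd c ` fst c))"

definition tnorm :: "('p \<Rightarrow> ('p, 'e) tangent \<Rightarrow> ('p, 'e) tangent \<Rightarrow> real) \<Rightarrow> 'p \<Rightarrow>
    ('p, 'e::euclidean_space) tangent \<Rightarrow> real" where
  "tnorm g p d = sqrt (g p d d)"

section \<open>Vector optimization\<close>

definition cone_le :: "'b::euclidean_space set \<Rightarrow> 'b \<Rightarrow> 'b \<Rightarrow> bool" where
  "cone_le K u v \<longleftrightarrow> v - u \<in> K"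

definition dual_cone :: "'b::euclidean_space set \<Rightarrow> 'b set" where
  "dual_cone K = {w. \<forall>y\<in>K. w \<bullet> y \<ge> 0}"

definition \<phi> :: "'b::euclidean_space set \<Rightarrow> 'b \<Rightarrow> real" where
  "\<phi> C y = (SUP w\<in>C. y \<bullet> w)"

definition descent_dir :: "('p, 'e::euclidean_space) chart set \<Rightarrow>
    ('p \<Rightarrow> ('p, 'e) tangent \<Rightarrow> ('p, 'e) tangent \<Rightarrow> real) \<Rightarrow> ('p \<Rightarrow> 'b::euclidean_space) \<Rightarrow> 'b set \<Rightarrow>
    'p \<Rightarrow> ('p, 'e) tangent" where
  "descent_dir A g F C p = (THE d. d \<in> tangent_space A p \<and>
     (\<forall>d'\<in>tangent_space A p.
        \<phi> C (DF A F p d) + (tnorm g p d)\<^sup>2 / 2 \<le> \<phi> C (DF A F p d') + (tnorm g p d')\<^sup>2 / 2))"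

definition \<psi> :: "('p, 'e::euclidean_space) chart set \<Rightarrow> ('p \<Rightarrow> 'b::euclidean_space) \<Rightarrow>
    ('p \<times> ('p, 'e) tangent \<Rightarrow> 'p) \<Rightarrow> 'b set \<Rightarrow> 'p \<Rightarrow> ('p, 'e) tangent \<Rightarrow> real \<Rightarrow> real" where
  "\<psi> A F R C p d t = \<phi> C (DF A F (R (p, tscale t d)) (DR A R p (tscale t d) d))"

text \<open>The iterates of a run that never stops; the stopping test v(x k) = 0 is negated separately
  where this is used.\<close>

definition cg_iterates :: "('p, 'e::euclidean_space) chart set \<Rightarrow>
    ('p \<Rightarrow> ('p, 'e) tangent \<Rightarrow> ('p, 'e) tangent \<Rightarrow> real) \<Rightarrow> ('p \<Rightarrow> 'b::euclidean_space) \<Rightarrow>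
    ('p \<times> ('p, 'e) tangent \<Rightarrow> 'p) \<Rightarrow> 'b set \<Rightarrow>
    (nat \<Rightarrow> real) \<Rightarrow> (nat \<Rightarrow> real) \<Rightarrow> (nat \<Rightarrow> 'p) \<Rightarrow> (nat \<Rightarrow> ('p, 'e) tangent) \<Rightarrow> bool" where
  "cg_iterates A g F R C \<beta> t x d \<longleftrightarrow>
     x 0 \<in> manifold_carrier A \<and>
     d 0 = descent_dir A g F C (x 0) \<and>
     (\<forall>k\<ge>1. d k = tadd (descent_dir A g F C (x k))
        (tscale (\<beta> k) (DR A R (x (k-1)) (tscale (t (k-1)) (d (k-1))) (d (k-1))))) \<and>
     (\<forall>k. t k > 0 \<and> x (Suc k) = R (x k, tscale (t k) (d k)))"

definition DY_denominator :: "('p, 'e::euclidean_space) chart set \<Rightarrow> ('p \<Rightarrow> 'b::euclidean_space) \<Rightarrow>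
    ('p \<times> ('p, 'e) tangent \<Rightarrow> 'p) \<Rightarrow> 'b set \<Rightarrow>
    (nat \<Rightarrow> real) \<Rightarrow> (nat \<Rightarrow> 'p) \<Rightarrow> (nat \<Rightarrow> ('p, 'e) tangent) \<Rightarrow> nat \<Rightarrow> real" where
  "DY_denominator A F R C t x d k =
     \<psi> A F R C (x (k-1)) (d (k-1)) (t (k-1)) - \<psi> A F R C (x (k-1)) (d (k-1)) 0"

definition \<beta>_DY :: "('p, 'e::euclidean_space) chart set \<Rightarrow>
    ('p \<Rightarrow> ('p, 'e) tangent \<Rightarrow> ('p, 'e) tangent \<Rightarrow> real) \<Rightarrow> ('p \<Rightarrow> 'b::euclidean_space) \<Rightarrow>
    ('p \<times> ('p, 'e) tangent \<Rightarrow> 'p) \<Rightarrow> 'b set \<Rightarrow>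
    (nat \<Rightarrow> real) \<Rightarrow> (nat \<Rightarrow> 'p) \<Rightarrow> (nat \<Rightarrow> ('p, 'e) tangent) \<Rightarrow> nat \<Rightarrow> real" where
  "\<beta>_DY A g F R C t x d k =
     - \<psi> A F R C (x k) (descent_dir A g F C (x k)) 0 / DY_denominator A F R C t x d k"

end

theory Submission
  imports Defs
begin

text \<open>By induction on k, the directional derivative \<open>\<psi>\<^sub>k(0) = \<phi>(DF(x\<^sub>k)[d\<^sub>k])\<close> is negative. For \<open>v(x\<^sub>k)\<close>
  this holds because the objective of the minimizer is at most its value 0 at the zero vector.
  The curvature condition then makes the Dai-Yuan denominator \<open>\<psi>\<^sub>k(t\<^sub>k) - \<psi>\<^sub>k(0)\<close> positive, and
  sublinearity of \<open>\<phi>\<close> bounds \<open>\<psi>\<^sub>k\<^sub>+\<^sub>1(0)\<close> by \<open>\<phi>(DF(x\<^sub>k\<^sub>+\<^sub>1)[v(x\<^sub>k\<^sub>+\<^sub>1)]) + \<beta>\<^sub>k\<^sub>+\<^sub>1 \<psi>\<^sub>k(t\<^sub>k)\<close>, which is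
  negative for \<open>0 \<le> \<beta>\<^sub>k\<^sub>+\<^sub>1 \<le> \<beta>\<^sup>D\<^sup>Y\<close>. The minimizer exists and is unique because in a chart the objective
  is a convex function plus a positive definite quadratic form.\<close>

section \<open>Strongly convex minimization\<close>

text \<open>Take for \<open>m\<close> the minimum of the form over the compact unit sphere;
  homogeneity of degree two carries the bound to all vectors.\<close>

lemma posdef_quadratic_lower_bound:
  fixes B :: "'e::euclidean_space \<Rightarrow> 'e \<Rightarrow> real"
  assumes "bilinear B" and pos: "\<And>a. a \<noteq> 0 \<Longrightarrow> B a a > 0"
  obtains m where "m > 0" "\<And>a. m * (norm a)\<^sup>2 \<le> B a a"
proof -
  interpret bounded_bilinear B
    using assms(1) bilinear_conv_bounded_bilinear by blast
  have ne: "sphere (0::'e) 1 \<noteq> {}" by simp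
  have "continuous_on (sphere 0 1) (\<lambda>a. B a a)"
    by (intro continuous_on continuous_intros)
  then obtain s where s: "s \<in> sphere 0 1" "\<And>a. a \<in> sphere 0 1 \<Longrightarrow> B s s \<le> B a a"
    using continuous_attains_inf[OF compact_sphere ne] by blast
  show thesis
  proof
    show "B s s > 0" using s(1) by (intro pos) auto
    fix a :: 'e
    show "B s s * (norm a)\<^sup>2 \<le> B a a"
    proof (cases "a = 0")
      case True
      then show ?thesis by (simp add: zero_left)
    next
      case False
      have "B s s \<le> B (a /\<^sub>R norm a) (a /\<^sub>R norm a)" using False by (intro s(2)) simp
      also have "\<dots> = B a a / (norm a)\<^sup>2"
        by (simp add: scaleR_left scaleR_right power2_eq_square divide_inverse)
      finally show ?thesis using False by (simp add: field_simps)
    qed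
  qed
qed

text \<open>The linear minorant \<open>l\<close> lets \<open>f\<close> fall at most linearly while
  the form grows quadratically, so a minimum over a large ball is global. Uniqueness is strict
  convexity, tested at a midpoint.\<close>

lemma convex_plus_posdef_has_unique_minimizer:
  fixes B :: "'e::euclidean_space \<Rightarrow> 'e \<Rightarrow> real" and f :: "'e \<Rightarrow> real"
  assumes bil: "bilinear B" and pos: "\<And>a. a \<noteq> 0 \<Longrightarrow> B a a > 0"
    and f: "convex_on UNIV f" and l: "linear l" "\<And>a. l a \<le> f a"
  shows "\<exists>!a. \<forall>b. f a + B a a / 2 \<le> f b + B b b / 2"
proof -
  let ?G = "\<lambda>a. f a + B a a / 2"
  interpret bounded_bilinear B
    using bil bilinear_conv_bounded_bilinear by blast
  obtain m where m: "m > 0" "\<And>a. m * (norm a)\<^sup>2 \<le> B a a"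
    using posdef_quadratic_lower_bound[OF bil pos] by blast
  obtain M where M: "M > 0" "\<And>a. norm (l a) \<le> M * norm a"
    using linear_bounded_pos[OF l(1)] by blast
  \<comment> \<open>Outside this radius half the form is at least
    \<open>(M + \<bar>f 0\<bar>) * norm a\<close>: the part with \<open>M\<close> absorbs the
    minorant. The summand 1 forces \<open>norm a > 1\<close>, so the rest still dominates
    \<open>f 0\<close>.\<close>
  define r where "r = 2 * (M + \<bar>f 0\<bar>) / m + 1"
  have r: "r \<ge> 1" using m(1) M(1) by (simp add: r_def)
  have outside: "?G 0 \<le> ?G a" if "norm a > r" for a
  proof -
    have "norm a > 1" using that r by simp
    have "2 * (M + \<bar>f 0\<bar>) / m \<le> norm a" using that by (simp add: r_def)
    then have "2 * (M + \<bar>f 0\<bar>) \<le> m * norm a" using m(1) by (simp add: field_simps)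
    then have "(2 * (M + \<bar>f 0\<bar>)) * norm a \<le> (m * norm a) * norm a"
      by (intro mult_right_mono) auto
    moreover have "\<bar>f 0\<bar> * 1 \<le> \<bar>f 0\<bar> * norm a"
      using \<open>norm a > 1\<close> by (intro mult_left_mono) auto
    moreover have "m * norm a * norm a \<le> B a a" using m(2)[of a] by (simp add: power2_eq_square mult.assoc)
    moreover have "- (M * norm a) \<le> f a" using M(2)[of a] l(2)[of a] by auto
    ultimately show ?thesis by (simp add: zero_left algebra_simps)
  qed
  have "continuous_on UNIV f" by (rule convex_on_continuous[OF open_UNIV f])
  then have "continuous_on (cball 0 r) f" by (rule continuous_on_subset) simp
  then have "continuous_on (cball 0 r) ?G" by (intro continuous_on continuous_intros) auto
  moreover have "cball (0::'e) r \<noteq> {}" using r by auto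
  ultimately obtain a where a: "a \<in> cball 0 r" "\<And>b. b \<in> cball 0 r \<Longrightarrow> ?G a \<le> ?G b"
    using continuous_attains_inf[OF compact_cball, of 0 r ?G] by blast
  have "?G a \<le> ?G b" for b
  proof (cases "norm b > r")
    case True
    have "?G a \<le> ?G 0" using r by (intro a(2)) simp
    also have "\<dots> \<le> ?G b" by (rule outside[OF True])
    finally show ?thesis .
  next
    case False
    then show ?thesis by (intro a(2)) simp
  qed
  moreover have "b = c" if b: "\<forall>z. ?G b \<le> ?G z" and c: "\<forall>z. ?G c \<le> ?G z" for b c
  proof (rule ccontr)
    assume "b \<noteq> c"
    define z where "z = (1/2) *\<^sub>R b + (1/2) *\<^sub>R c"
    have "f z \<le> (1/2) * f b + (1/2) * f c"
      unfolding z_def using convex_onD[OF f, of "1/2" b c] by simp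
    \<comment> \<open>Parallelogram identity: at the midpoint the form lies strictly below the
      average of its values at \<open>b\<close> and \<open>c\<close>, so \<open>z\<close> would beat
      two minimizers.\<close>
    moreover have "B z z = B b b / 2 + B c c / 2 - B (b - c) (b - c) / 4"
      unfolding z_def by (simp add: add_left add_right diff_left diff_right scaleR_left scaleR_right field_simps)
    moreover have "B (b - c) (b - c) > 0" using pos \<open>b \<noteq> c\<close> by simp
    moreover have "?G b \<le> ?G z" "?G c \<le> ?G z" using b c by auto
    ultimately show False by (simp add: field_simps)
  qed
  ultimately show ?thesis by blast
qed

section \<open>The support function\<close>

context
  fixes C :: "'b::euclidean_space set"
  assumes C: "compact C" "C \<noteq> {}"
begin

text \<open>Without an upper bound the real-valued \<open>SUP\<close> in \<open>\<phi>\<close> would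
  carry no information.\<close>

lemma bdd_above_inner_compact: "bdd_above ((\<lambda>w. y \<bullet> w) ` C)"
  by (intro bounded_imp_bdd_above compact_imp_bounded compact_continuous_image C continuous_intros)

lemma \<phi>_ge: "w \<in> C \<Longrightarrow> y \<bullet> w \<le> \<phi> C y"
  unfolding \<phi>_def by (intro cSUP_upper bdd_above_inner_compact)

lemma \<phi>_add: "\<phi> C (y + z) \<le> \<phi> C y + \<phi> C z"
  unfolding \<phi>_def[of C "y + z"] using C(2)
  by (intro cSUP_least) (auto simp: inner_add_left intro!: add_mono \<phi>_ge)

lemma \<phi>_zero: "\<phi> C 0 = 0"
  using C(2) by (simp add: \<phi>_def)

text \<open>This half of positive homogeneity serves both convexity and the later estimate for
  conjugate directions.\<close>

lemma \<phi>_scaleR_le: "r \<ge> 0 \<Longrightarrow> \<phi> C (r *\<^sub>R y) \<le> r * \<phi> C y"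
  unfolding \<phi>_def[of C "r *\<^sub>R y"] using C(2)
  by (intro cSUP_least) (auto intro!: mult_left_mono \<phi>_ge)

lemma convex_on_\<phi>_linear:
  assumes "linear L" shows "convex_on UNIV (\<lambda>a. \<phi> C (L a))"
proof (rule convex_onI)
  fix r :: real and a b assume "0 < r" "r < 1"
  have "L ((1 - r) *\<^sub>R a + r *\<^sub>R b) = (1 - r) *\<^sub>R L a + r *\<^sub>R L b"
    using assms by (simp add: linear_add linear_scale)
  with \<phi>_add[of "(1 - r) *\<^sub>R L a" "r *\<^sub>R L b"] \<phi>_scaleR_le[of "1 - r" "L a"] \<phi>_scaleR_le[of r "L b"]
    \<open>0 < r\<close> \<open>r < 1\<close>
  show "\<phi> C (L ((1 - r) *\<^sub>R a + r *\<^sub>R b)) \<le> (1 - r) * \<phi> C (L a) + r * \<phi> C (L b)" by simp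
qed simp

end

section \<open>Tangent spaces\<close>

lemma chart_inv_eq:
  "inj_on (snd c) (fst c) \<Longrightarrow> p \<in> fst c \<Longrightarrow> chart_inv c (snd c p) = p"
  by (simp add: chart_inv_def)

lemma smooth_on_imp_differentiable: "smooth_on f S \<Longrightarrow> x \<in> S \<Longrightarrow> f differentiable (at x)"
  unfolding smooth_on_def by (metis Ck_on.simps(2))

lemma chart_rangeE:
  assumes "p \<in> manifold_carrier A" obtains c where "c \<in> charts_at A p"
  using assms by (auto simp: manifold_carrier_def charts_at_def)

lemma tangent_spaceI:
  assumes "\<And>c. c \<notin> charts_at A p \<Longrightarrow> v c = 0"
    and "\<And>c c'. c \<in> charts_at A p \<Longrightarrow> c' \<in> charts_at A p \<Longrightarrow>
      v c' = frechet_derivative (snd c' \<circ> chart_inv c) (at (snd c p)) (v c)"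
  shows "v \<in> tangent_space A p"
  using assms unfolding tangent_space_def by blast

lemma tangent_spaceD:
  assumes "v \<in> tangent_space A p"
  shows "c \<notin> charts_at A p \<Longrightarrow> v c = 0"
    and "c \<in> charts_at A p \<Longrightarrow> c' \<in> charts_at A p \<Longrightarrow>
      v c' = frechet_derivative (snd c' \<circ> chart_inv c) (at (snd c p)) (v c)"
  using assms unfolding tangent_space_def by blast+

context
  fixes A :: "('p, 'e::euclidean_space) chart set"
  assumes A: "smooth_atlas A"
begin

lemma atlas_inj: "c \<in> A \<Longrightarrow> inj_on (snd c) (fst c)"
  and atlas_open: "c \<in> A \<Longrightarrow> open (snd c ` fst c)"
  and atlas_open_Int: "c \<in> A \<Longrightarrow> c' \<in> A \<Longrightarrow> open (snd c ` (fst c \<inter> fst c'))"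
  and atlas_smooth: "c \<in> A \<Longrightarrow> c' \<in> A \<Longrightarrow>
    smooth_on (snd c' \<circ> chart_inv c) (snd c ` (fst c \<inter> fst c'))"
  using A by (auto simp: smooth_atlas_def)

lemma transition_differentiable:
  assumes "c \<in> charts_at A p" "c' \<in> charts_at A p"
  shows "(snd c' \<circ> chart_inv c) differentiable (at (snd c p))"
  using assms by (intro smooth_on_imp_differentiable[OF atlas_smooth]) (auto simp: charts_at_def)

text \<open>Near \<open>a\<close> the map \<open>snd c' \<circ> h\<close> factors through the chart
  \<open>c\<close>, so this is the chain rule. The factorization is only local, since
  \<open>chart_inv c\<close> undoes \<open>snd c\<close> on \<open>fst c\<close> alone. With
  \<open>h\<close> an inverse chart or a map on a fibre, it yields the compatibility condition of
  tangent vectors.\<close>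

lemma frechet_derivative_change_chart:
  fixes h :: "'f::real_normed_vector \<Rightarrow> 'p"
  assumes c: "c \<in> charts_at A (h a)" "c' \<in> charts_at A (h a)"
    and diff: "(snd c \<circ> h) differentiable (at a)"
    and ev: "\<forall>\<^sub>F y in nhds a. h y \<in> fst c"
  shows "frechet_derivative (snd c' \<circ> h) (at a) u =
    frechet_derivative (snd c' \<circ> chart_inv c) (at (snd c (h a))) (frechet_derivative (snd c \<circ> h) (at a) u)"
proof -
  let ?T = "snd c' \<circ> chart_inv c"
  have "((snd c \<circ> h) has_derivative frechet_derivative (snd c \<circ> h) (at a)) (at a)"
    using diff by (simp add: frechet_derivative_works)
  moreover have "(?T has_derivative frechet_derivative ?T (at (snd c (h a)))) (at ((snd c \<circ> h) a))"
    using transition_differentiable[OF c] by (simp add: frechet_derivative_works)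
  ultimately have chain: "((?T \<circ> (snd c \<circ> h)) has_derivative
      (frechet_derivative ?T (at (snd c (h a))) \<circ> frechet_derivative (snd c \<circ> h) (at a))) (at a)"
    by (rule diff_chain_at)
  have "\<forall>\<^sub>F y in nhds a. (?T \<circ> (snd c \<circ> h)) y = (snd c' \<circ> h) y"
    using ev by eventually_elim (use c(1) in \<open>simp add: chart_inv_eq atlas_inj charts_at_def\<close>)
  then have "\<forall>\<^sub>F y in at a. (?T \<circ> (snd c \<circ> h)) y = (snd c' \<circ> h) y"
    "(?T \<circ> (snd c \<circ> h)) a = (snd c' \<circ> h) a"
    by (simp_all add: eventually_nhds_conv_at)
  with chain have "((snd c' \<circ> h) has_derivative
      (frechet_derivative ?T (at (snd c (h a))) \<circ> frechet_derivative (snd c \<circ> h) (at a))) (at a)"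
    by (rule has_derivative_transform_eventually) simp
  from frechet_derivative_at[OF this] show ?thesis by (metis comp_apply)
qed

text \<open>The composite is the identity on the open image of the chart, which is enough for the
  derivative at an interior point.\<close>

lemma frechet_derivative_transition_self:
  assumes "c \<in> charts_at A p"
  shows "frechet_derivative (snd c \<circ> chart_inv c) (at (snd c p)) a = a"
proof -
  have c: "c \<in> A" "p \<in> fst c" using assms by (auto simp: charts_at_def)
  have "((\<lambda>y. y) has_derivative (\<lambda>y. y)) (at (snd c p))" by simp
  then have "((snd c \<circ> chart_inv c) has_derivative (\<lambda>y. y)) (at (snd c p))"
    by (rule has_derivative_transform_within_open[OF _ atlas_open[OF c(1)]])
      (use c in \<open>auto simp: chart_inv_eq atlas_inj\<close>)
  from frechet_derivative_at[OF this] show ?thesis by metis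
qed

lemma eventually_chart_inv_in_chart:
  assumes "c \<in> charts_at A p" "c' \<in> charts_at A p"
  shows "\<forall>\<^sub>F y in nhds (snd c p). chart_inv c y \<in> fst c'"
proof -
  have c: "c \<in> A" "p \<in> fst c" "c' \<in> A" "p \<in> fst c'" using assms by (auto simp: charts_at_def)
  show ?thesis unfolding eventually_nhds
    using c by (intro exI[of _ "snd c ` (fst c \<inter> fst c')"])
      (auto simp: atlas_open_Int chart_inv_eq atlas_inj)
qed

text \<open>Push \<open>a\<close> from \<open>c\<close> into every other chart by the derivative of
  the transition map; the chain rule makes the resulting family compatible.\<close>

lemma tangent_space_coord_surj:
  assumes c: "c \<in> charts_at A p"
  shows "\<exists>v\<in>tangent_space A p. v c = a"
proof -
  define v where "v = (\<lambda>c'. if c' \<in> charts_at A p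
    then frechet_derivative (snd c' \<circ> chart_inv c) (at (snd c p)) a else 0)"
  have inv: "chart_inv c (snd c p) = p"
    using c by (auto simp: charts_at_def chart_inv_eq atlas_inj)
  have "v c'' = frechet_derivative (snd c'' \<circ> chart_inv c') (at (snd c' p)) (v c')"
    if "c' \<in> charts_at A p" "c'' \<in> charts_at A p" for c' c''
    using frechet_derivative_change_chart[of c' "chart_inv c" "snd c p" c'' a] that
      transition_differentiable[OF c that(1)] eventually_chart_inv_in_chart[OF c that(1)]
    by (simp add: v_def inv)
  then have "v \<in> tangent_space A p" by (rule tangent_spaceI[rotated]) (simp_all add: v_def)
  moreover have "v c = a" using c by (simp add: v_def frechet_derivative_transition_self)
  ultimately show ?thesis by blast
qed

lemma tangent_space_coord_inj:
  assumes "c \<in> charts_at A p"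
  shows "inj_on (\<lambda>v. v c) (tangent_space A p)"
proof (rule inj_onI, rule ext)
  fix v w c' assume "v \<in> tangent_space A p" "w \<in> tangent_space A p" "v c = w c"
  then show "v c' = w c'" using assms tangent_spaceD by metis
qed

text \<open>With \<open>coord_vector_unique\<close> this makes \<open>coord_vector A c p\<close> a
  two-sided inverse of reading off the coordinate in \<open>c\<close>, so problems on the tangent
  space can be moved to the model space.\<close>

lemma coord_vector:
  assumes "c \<in> charts_at A p"
  shows "coord_vector A c p a \<in> tangent_space A p" "coord_vector A c p a c = a"
proof -
  have "a \<in> (\<lambda>v. v c) ` tangent_space A p" using tangent_space_coord_surj[OF assms, of a] by auto
  then show "coord_vector A c p a \<in> tangent_space A p" "coord_vector A c p a c = a"
    unfolding coord_vector_def by (rule inv_into_into, rule f_inv_into_f)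
qed

lemma coord_vector_unique:
  assumes "c \<in> charts_at A p" "v \<in> tangent_space A p"
  shows "coord_vector A c p (v c) = v"
  unfolding coord_vector_def
  using inv_into_f_f[OF tangent_space_coord_inj[OF assms(1)] assms(2)] .

section \<open>Vector space operations on tangent spaces and in coordinates\<close>

lemma tangent_space_linear_frechet:
  assumes "c \<in> charts_at A p" "c' \<in> charts_at A p"
  shows "linear (frechet_derivative (snd c' \<circ> chart_inv c) (at (snd c p)))"
  by (rule linear_frechet_derivative[OF transition_differentiable[OF assms]])

lemma tzero_in_tangent_space: "tzero \<in> tangent_space A p"
  by (rule tangent_spaceI) (simp_all add: tzero_def linear_0[OF tangent_space_linear_frechet])

lemma tadd_in_tangent_space:
  assumes v: "v \<in> tangent_space A p" and w: "w \<in> tangent_space A p"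
  shows "tadd v w \<in> tangent_space A p"
proof (rule tangent_spaceI)
  fix c assume c: "c \<notin> charts_at A p"
  then show "tadd v w c = 0" by (simp add: tadd_def tangent_spaceD(1)[OF v c] tangent_spaceD(1)[OF w c])
next
  fix c c' assume c: "c \<in> charts_at A p" "c' \<in> charts_at A p"
  show "tadd v w c' = frechet_derivative (snd c' \<circ> chart_inv c) (at (snd c p)) (tadd v w c)"
    by (simp only: tadd_def linear_add[OF tangent_space_linear_frechet[OF c]]
      tangent_spaceD(2)[OF v c] tangent_spaceD(2)[OF w c])
qed

lemma tscale_in_tangent_space:
  assumes v: "v \<in> tangent_space A p"
  shows "tscale r v \<in> tangent_space A p"
proof (rule tangent_spaceI)
  fix c assume c: "c \<notin> charts_at A p"
  then show "tscale r v c = 0" by (simp add: tscale_def tangent_spaceD(1)[OF v c])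
next
  fix c c' assume c: "c \<in> charts_at A p" "c' \<in> charts_at A p"
  show "tscale r v c' = frechet_derivative (snd c' \<circ> chart_inv c) (at (snd c p)) (tscale r v c)"
    by (simp only: tscale_def linear_scale[OF tangent_space_linear_frechet[OF c]]
      tangent_spaceD(2)[OF v c])
qed

lemma coord_vector_add:
  assumes "c \<in> charts_at A p"
  shows "coord_vector A c p (a + b) = tadd (coord_vector A c p a) (coord_vector A c p b)"
  using coord_vector_unique[OF assms tadd_in_tangent_space[OF coord_vector(1)[OF assms, of a] coord_vector(1)[OF assms, of b]]]
  by (simp add: tadd_def coord_vector(2)[OF assms])

lemma coord_vector_scale:
  assumes "c \<in> charts_at A p"
  shows "coord_vector A c p (r *\<^sub>R a) = tscale r (coord_vector A c p a)"
  using coord_vector_unique[OF assms tscale_in_tangent_space[OF coord_vector(1)[OF assms, of a]]]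
  by (simp add: tscale_def coord_vector(2)[OF assms])

section \<open>Open chart domains and the derivative in coordinates\<close>

lemma carrier_topology: "topspace (manifold_topology A) \<subseteq> manifold_carrier A"
  using openin_manifold_topology[of A "topspace (manifold_topology A)", OF atlas_inj] by simp

lemma openin_chart:
  assumes c: "c \<in> A" shows "openin (manifold_topology A) (fst c)"
proof -
  have "open (snd c' ` (fst c \<inter> fst c'))" if "c' \<in> A" for c'
    using atlas_open_Int[OF that c] by (simp only: Int_commute)
  moreover have "fst c \<subseteq> manifold_carrier A" using c unfolding manifold_carrier_def by blast
  ultimately show ?thesis by (simp add: openin_manifold_topology[OF atlas_inj])
qed

text \<open>The chart \<open>c\<close> is the very one that \<open>differential\<close> selects, so
  the identity follows by unfolding and no independence of the chart has to be proved.\<close>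

lemma DF_linear_coord:
  fixes F :: "'p \<Rightarrow> 'b::euclidean_space"
  assumes F: "Ck_map 1 A euclidean_atlas F" and p: "p \<in> manifold_carrier A"
  obtains c L where "c \<in> charts_at A p" "linear L" "\<And>v. DF A F p v = L (v c)"
proof
  define c where "c = (SOME c. c \<in> charts_at A p)"
  show c: "c \<in> charts_at A p" unfolding c_def by (rule chart_rangeE[OF p]) (rule someI)
  let ?F = "(\<lambda>y. y) \<circ> F \<circ> chart_inv c"
  have "Ck_on 1 ?F (snd c ` (fst c \<inter> F -` UNIV))"
    using F c by (force simp: Ck_map_def euclidean_atlas_def charts_at_def)
  then have "?F differentiable (at (snd c p))" using c by (auto simp: charts_at_def)
  then show "linear (frechet_derivative ?F (at (snd c p)))" by (rule linear_frechet_derivative)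
  have "(UNIV, \<lambda>y. y) \<in> charts_at euclidean_atlas (F p)"
    by (simp add: charts_at_def euclidean_atlas_def)
  then show "DF A F p v = frechet_derivative ?F (at (snd c p)) (v c)" for v
    by (simp add: DF_def differential_def Let_def flip: c_def)
qed

section \<open>Retractions\<close>

text \<open>The base coordinates determine the point, and then the fibre coordinates determine the
  vector. This opens the way to \<open>openin_manifold_topology\<close> for the bundle.\<close>

lemma tangent_bundle_inj:
  assumes "b \<in> tangent_bundle A" shows "inj_on (snd b) (fst b)"
proof -
  obtain c where c: "c \<in> A" and b: "b = (Sigma (fst c) (tangent_space A), \<lambda>(p, v). (snd c p, v c))"
    using assms by (auto simp: tangent_bundle_def)
  show ?thesis
  proof (rule inj_onI)
    fix z z' assume z: "z \<in> fst b" "z' \<in> fst b" "snd b z = snd b z'"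
    obtain p v q w where zz: "z = (p, v)" "z' = (q, w)" by fastforce
    have "p = q" using z atlas_inj[OF c] by (auto simp: b zz inj_on_def)
    moreover from this have "v = w"
      using z tangent_space_coord_inj[of c p] c by (auto simp: b zz inj_on_def charts_at_def)
    ultimately show "z = z'" by (simp add: zz)
  qed
qed

text \<open>The carrier is open, because a bundle chart maps its whole domain onto the open chart
  image times the full model space. Continuity of \<open>R\<close> thereby applies at every point of
  the bundle.\<close>

lemma topspace_tangent_bundle:
  "manifold_carrier (tangent_bundle A) \<subseteq> topspace (manifold_topology (tangent_bundle A))"
proof (rule openin_subset, subst openin_manifold_topology[OF tangent_bundle_inj], assumption,
    intro conjI ballI subset_refl)
  fix b assume "b \<in> tangent_bundle A"
  then obtain c where c: "c \<in> A" and b: "b = (Sigma (fst c) (tangent_space A), \<lambda>(p, v). (snd c p, v c))"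
    and sub: "fst b \<subseteq> manifold_carrier (tangent_bundle A)"
    by (auto simp: tangent_bundle_def manifold_carrier_def)
  have "snd b ` (manifold_carrier (tangent_bundle A) \<inter> fst b) = snd b ` fst b"
    using sub by (simp add: Int_absorb1)
  also have "\<dots> = (snd c ` fst c) \<times> UNIV"
  proof
    show "(snd c ` fst c) \<times> UNIV \<subseteq> snd b ` fst b"
    proof clarify
      fix p a assume p: "p \<in> fst c"
      then have "c \<in> charts_at A p" using c by (simp add: charts_at_def)
      from coord_vector[OF this, of a] p show "(snd c p, a) \<in> snd b ` fst b"
        by (auto simp: b intro!: image_eqI[of _ _ "(p, coord_vector A c p a)"])
    qed
  qed (auto simp: b)
  finally show "open (snd b ` (manifold_carrier (tangent_bundle A) \<inter> fst b))"
    using atlas_open[OF c] by (simp add: open_Times)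
qed

context
  fixes R :: "'p \<times> ('p, 'e) tangent \<Rightarrow> 'p"
  assumes R: "smooth_map (tangent_bundle A) A R"
begin

lemma smooth_map_continuous: "continuous_map (manifold_topology (tangent_bundle A)) (manifold_topology A) R"
  using R by (simp add: smooth_map_def Ck_map_def)

lemma bundle_map_in_carrier:
  assumes "p \<in> manifold_carrier A" "w \<in> tangent_space A p"
  shows "R (p, w) \<in> manifold_carrier A"
proof -
  have "(p, w) \<in> manifold_carrier (tangent_bundle A)"
    using assms by (auto simp: manifold_carrier_def tangent_bundle_def)
  then show ?thesis
    using smooth_map_continuous topspace_tangent_bundle carrier_topology
    by (auto simp: continuous_map_def)
qed

text \<open>In bundle coordinates, restricting to the fibre over \<open>p\<close> means composing
  with the affine map sending \<open>a\<close> to \<open>(snd c p, a)\<close>. Differentiability and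
  openness of preimages pass through this composition.\<close>

lemma bundle_map_fiber:
  assumes c: "c \<in> charts_at A p" and w: "w \<in> tangent_space A p"
    and c': "c' \<in> charts_at A (R (p, w))"
  defines "h \<equiv> \<lambda>a. R (p, coord_vector A c p a)"
  shows "(snd c' \<circ> h) differentiable (at (w c))"
    and "\<forall>\<^sub>F a in nhds (w c). h a \<in> fst c'"
proof -
  define b where "b = (Sigma (fst c) (tangent_space A), \<lambda>(p :: 'p, v :: ('p, 'e) tangent). (snd c p, v c))"
  have cA: "c \<in> A" "p \<in> fst c" "c' \<in> A" "R (p, w) \<in> fst c'"
    using c c' by (auto simp: charts_at_def)
  have bA: "b \<in> tangent_bundle A" using cA by (auto simp: b_def tangent_bundle_def)
  define S where "S = snd b ` (fst b \<inter> R -` fst c')"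
  have coord: "(p, coord_vector A c p a) \<in> fst b" "snd b (p, coord_vector A c p a) = (snd c p, a)" for a
    using coord_vector[OF c, of a] cA by (auto simp: b_def)
  have inv: "chart_inv b (snd c p, a) = (p, coord_vector A c p a)" for a
    using chart_inv_eq[OF tangent_bundle_inj[OF bA] coord(1)[of a]] by (simp add: coord(2))
  have inS: "(snd c p, w c) \<in> S"
    unfolding S_def using cA w by (auto simp: b_def intro!: image_eqI[of _ _ "(p, w)"])
  have "fst b \<subseteq> topspace (manifold_topology (tangent_bundle A))"
    using bA topspace_tangent_bundle by (auto simp: manifold_carrier_def)
  \<comment> \<open>Continuity controls preimages only within the topspace, hence this rewriting
    before openness of \<open>S\<close> can be concluded.\<close>
  then have "fst b \<inter> R -` fst c' = {z \<in> topspace (manifold_topology (tangent_bundle A)). R z \<in> fst c'} \<inter> fst b"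
    by auto
  moreover have "openin (manifold_topology (tangent_bundle A))
      {z \<in> topspace (manifold_topology (tangent_bundle A)). R z \<in> fst c'}"
    using smooth_map_continuous openin_chart[OF cA(3)] by (simp add: continuous_map_def)
  ultimately have "open S"
    using bA by (simp add: S_def openin_manifold_topology[OF tangent_bundle_inj])
  have "Ck_on 1 (snd c' \<circ> R \<circ> chart_inv b) S"
    using R bA cA unfolding smooth_map_def Ck_map_def S_def by blast
  then have "(snd c' \<circ> R \<circ> chart_inv b) differentiable (at (snd c p, w c))"
    using inS by simp
  moreover have "((\<lambda>a. (snd c p, a)) has_derivative (\<lambda>a. (0, a))) (at (w c))"
    by (intro derivative_intros)
  then have "(\<lambda>a. (snd c p, a)) differentiable (at (w c))"
    by (rule differentiableI)
  ultimately have "((snd c' \<circ> R \<circ> chart_inv b) \<circ> (\<lambda>a. (snd c p, a))) differentiable (at (w c))"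
    by (intro differentiable_chain_at) auto
  then show "(snd c' \<circ> h) differentiable (at (w c))"
    by (simp add: o_def inv h_def)
  have "open ((\<lambda>a. (snd c p, a)) -` S)"
    by (intro open_vimage \<open>open S\<close> continuous_intros)
  moreover have "h a \<in> fst c'" if "(snd c p, a) \<in> S" for a
  proof -
    from that obtain z where z: "z \<in> fst b" "R z \<in> fst c'" "snd b z = (snd c p, a)"
      unfolding S_def by auto
    have "z = (p, coord_vector A c p a)"
      using inv[of a] chart_inv_eq[OF tangent_bundle_inj[OF bA] z(1)] z(3) by simp
    with z(2) show ?thesis by (simp add: h_def)
  qed
  ultimately show "\<forall>\<^sub>F a in nhds (w c). h a \<in> fst c'"
    using inS unfolding eventually_nhds by blast
qed

text \<open>All coordinates of the result are derivatives of one map \<open>h\<close> on the model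
  space, seen in different target charts, so the change-of-chart rule relates them as
  required.\<close>

lemma DR_in_tangent_space:
  assumes p: "p \<in> manifold_carrier A" and w: "w \<in> tangent_space A p"
  shows "DR A R p w u \<in> tangent_space A (R (p, w))"
proof -
  let ?L = "tangent_space_atlas A p"
  \<comment> \<open>This is the chart chosen inside \<open>differential\<close>; it evaluates
    tangent vectors at some chart \<open>c\<close> around \<open>p\<close>, so its inverse is
    \<open>coord_vector A c p\<close>.\<close>
  define b where "b = (SOME b. b \<in> charts_at ?L w)"
  obtain c0 where "c0 \<in> charts_at A p" using chart_rangeE[OF p] .
  then have "(tangent_space A p, \<lambda>v. v c0) \<in> charts_at ?L w"
    using w by (auto simp: tangent_space_atlas_def charts_at_def)
  then have "\<exists>b. b \<in> charts_at ?L w" by blast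
  then have "b \<in> charts_at ?L w" unfolding b_def by (rule someI_ex)
  then obtain c where c: "c \<in> charts_at A p" and b: "b = (tangent_space A p, \<lambda>v. v c)"
    by (auto simp: tangent_space_atlas_def charts_at_def)
  define h where "h = (\<lambda>a. R (p, coord_vector A c p a))"
  have h: "h (w c) = R (p, w)" by (simp add: h_def coord_vector_unique[OF c w])
  have "chart_inv b = coord_vector A c p"
    by (simp add: chart_inv_def b coord_vector_def fun_eq_iff)
  then have "snd c' \<circ> (\<lambda>w. R (p, w)) \<circ> chart_inv b = snd c' \<circ> h" for c' :: "('p, 'e) chart"
    by (simp add: o_def h_def)
  moreover have "snd b w = w c" by (simp add: b)
  ultimately have DR: "DR A R p w u = (\<lambda>c'. if c' \<in> charts_at A (R (p, w))
     then frechet_derivative (snd c' \<circ> h) (at (w c)) (as_tangent ?L w u b) else 0)"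
    by (simp only: DR_def differential_def Let_def flip: b_def)
  have "DR A R p w u c'' = frechet_derivative (snd c'' \<circ> chart_inv c') (at (snd c' (R (p, w)))) (DR A R p w u c')"
    if "c' \<in> charts_at A (R (p, w))" "c'' \<in> charts_at A (R (p, w))" for c' c''
  proof -
    have "\<forall>\<^sub>F a in nhds (w c). h a \<in> fst c'" "(snd c' \<circ> h) differentiable (at (w c))"
      using bundle_map_fiber[OF c w that(1)] by (simp_all add: h_def)
    then show ?thesis
      using frechet_derivative_change_chart[of c' h "w c" c''] that by (simp add: DR h)
  qed
  then show ?thesis by (rule tangent_spaceI[rotated]) (simp_all add: DR)
qed

end

section \<open>The steepest descent direction\<close>

text \<open>In coordinates the objective is a convex function plus half a positive definite form.
  Its minimizer exists and is unique, so the \<open>THE\<close> in \<open>descent_dir\<close>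
  denotes it.\<close>

lemma descent_dir_minimizer:
  fixes F :: "'p \<Rightarrow> 'b::euclidean_space"
  assumes g: "riemannian_metric A g" and F: "Ck_map 1 A euclidean_atlas F"
    and C: "compact C" "C \<noteq> {}" and p: "p \<in> manifold_carrier A"
  defines "v \<equiv> descent_dir A g F C p"
  shows "v \<in> tangent_space A p"
    and "\<And>w. w \<in> tangent_space A p \<Longrightarrow>
      \<phi> C (DF A F p v) + (tnorm g p v)\<^sup>2 / 2 \<le> \<phi> C (DF A F p w) + (tnorm g p w)\<^sup>2 / 2"
proof -
  let ?T = "tangent_space A p"
  let ?G = "\<lambda>w. \<phi> C (DF A F p w) + (tnorm g p w)\<^sup>2 / 2"
  obtain c L where c: "c \<in> charts_at A p" and L: "linear L" "\<And>v. DF A F p v = L (v c)"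
    using DF_linear_coord[OF F p] by blast
  let ?V = "coord_vector A c p"
  have gsym: "g p u w = g p w u" and gadd: "z \<in> ?T \<Longrightarrow> g p (tadd u z) w = g p u w + g p z w"
    and gscale: "g p (tscale r u) w = r * g p u w" and gpos: "u \<noteq> tzero \<Longrightarrow> g p u u > 0"
    if "u \<in> ?T" "w \<in> ?T" for u w z r
    using g p that unfolding riemannian_metric_def by blast+
  define B where "B a b = g p (?V a) (?V b)" for a b
  have Bsym: "B a b = B b a" for a b
    unfolding B_def by (intro gsym coord_vector(1)[OF c])
  have Blin: "linear (\<lambda>a. B a b)" for b
    by (rule linearI)
      (simp_all add: B_def coord_vector_add[OF c] coord_vector_scale[OF c] gadd gscale coord_vector(1)[OF c])
  have "linear (B a)" for a
  proof -
    \<comment> \<open>The metric axioms state linearity in the first argument; symmetry supplies the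
      second.\<close>
    have "B a = (\<lambda>b. B b a)" using Bsym by blast
    then have "linear (B a) \<longleftrightarrow> linear (\<lambda>b. B b a)" by (rule arg_cong)
    then show ?thesis using Blin[of a] by (rule iffD2)
  qed
  then have bil: "bilinear B" using Blin by (simp add: bilinear_def)
  have Bpos: "B a a > 0" if "a \<noteq> 0" for a
  proof -
    have "?V a \<noteq> tzero" using coord_vector(2)[OF c, of a] that by (auto simp: tzero_def)
    then show ?thesis
      unfolding B_def by (rule gpos[OF coord_vector(1)[OF c] coord_vector(1)[OF c]])
  qed
  \<comment> \<open>Pairing with any single element of \<open>C\<close> gives the linear minorant of
    the supremum.\<close>
  obtain w0 where w0: "w0 \<in> C" using C(2) by blast
  have lin: "linear (\<lambda>a. L a \<bullet> w0)"
    using L(1) by (intro linearI) (simp_all add: linear_add linear_scale inner_add_left)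
  have ex1: "\<exists>!a. \<forall>b. \<phi> C (L a) + B a a / 2 \<le> \<phi> C (L b) + B b b / 2"
    by (rule convex_plus_posdef_has_unique_minimizer
        [OF bil Bpos convex_on_\<phi>_linear[OF C L(1)] lin \<phi>_ge[OF C w0]])
  have G: "?G w = \<phi> C (L (w c)) + B (w c) (w c) / 2" if "w \<in> ?T" for w
  proof -
    \<comment> \<open>Nonnegativity is what cancels the square against the root in
      \<open>tnorm\<close>.\<close>
    have "g p w w \<ge> 0"
    proof (cases "w = tzero")
      case True
      then show ?thesis using gscale[OF that that, of 0] by (simp add: tscale_def tzero_def)
    qed (use gpos[OF that that] in simp)
    then show ?thesis by (simp add: tnorm_def B_def coord_vector_unique[OF c that] L(2))
  qed
  obtain a where a: "\<forall>b. \<phi> C (L a) + B a a / 2 \<le> \<phi> C (L b) + B b b / 2" using ex1 by blast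
  have "\<exists>!v. v \<in> ?T \<and> (\<forall>w\<in>?T. ?G v \<le> ?G w)"
  proof (rule ex1I)
    show "?V a \<in> ?T \<and> (\<forall>w\<in>?T. ?G (?V a) \<le> ?G w)"
      using a by (simp add: G coord_vector[OF c])
    fix u assume u: "u \<in> ?T \<and> (\<forall>w\<in>?T. ?G u \<le> ?G w)"
    have "\<phi> C (L (u c)) + B (u c) (u c) / 2 \<le> \<phi> C (L b) + B b b / 2" for b
      using u G[of u] G[OF coord_vector(1)[OF c, of b]] coord_vector[OF c, of b] by metis
    then have "u c = a" using a ex1 by blast
    then show "u = ?V a" using u coord_vector_unique[OF c, of u] by simp
  qed
  from theI'[OF this] show "v \<in> ?T" and "\<And>w. w \<in> ?T \<Longrightarrow> ?G v \<le> ?G w"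
    unfolding v_def descent_dir_def by blast+
qed

text \<open>Comparison with the zero vector leaves at most
  \<open>- (tnorm g p v)\<^sup>2 / 2\<close> for the directional term, where \<open>v\<close> is the
  minimizer; this is strictly negative as \<open>v\<close> is nonzero.\<close>

lemma descent_dir_negative:
  fixes F :: "'p \<Rightarrow> 'b::euclidean_space"
  assumes g: "riemannian_metric A g" and F: "Ck_map 1 A euclidean_atlas F"
    and C: "compact C" "C \<noteq> {}" and p: "p \<in> manifold_carrier A"
    and ne: "descent_dir A g F C p \<noteq> tzero"
  shows "\<phi> C (DF A F p (descent_dir A g F C p)) < 0"
proof -
  let ?v = "descent_dir A g F C p"
  obtain c L where L: "linear L" "\<And>v. DF A F p v = L (v c)"
    using DF_linear_coord[OF F p] by blast
  have v: "?v \<in> tangent_space A p"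
    using descent_dir_minimizer[OF g F C p] by blast
  have "g p (tscale 0 tzero) tzero = 0 * g p tzero tzero"
    using g p tzero_in_tangent_space unfolding riemannian_metric_def by blast
  then have "tnorm g p tzero = 0" by (simp add: tnorm_def tscale_def tzero_def)
  moreover have "\<phi> C (DF A F p tzero) = 0"
    using L by (simp add: tzero_def linear_0 \<phi>_zero[OF C])
  moreover have "(tnorm g p ?v)\<^sup>2 > 0"
    using g p v ne unfolding riemannian_metric_def tnorm_def by (metis real_sqrt_gt_zero zero_less_power)
  moreover have "\<phi> C (DF A F p ?v) + (tnorm g p ?v)\<^sup>2 / 2
      \<le> \<phi> C (DF A F p tzero) + (tnorm g p tzero)\<^sup>2 / 2"
    by (rule descent_dir_minimizer(2)[OF g F C p tzero_in_tangent_space])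
  ultimately show ?thesis by (smt (verit) half_gt_zero zero_power2 div_0)
qed

section \<open>Tangency of the iterates\<close>

lemma \<psi>_at_0:
  assumes "smooth_retraction A R" "p \<in> manifold_carrier A" "h \<in> tangent_space A p"
  shows "\<psi> A F R C p h 0 = \<phi> C (DF A F p h)"
proof -
  have "tscale 0 h = tzero" by (simp add: tscale_def tzero_def)
  \<comment> \<open>One retraction axiom restores the base point, the other turns the derivative at
    the zero vector into the identity on tangent vectors.\<close>
  then show ?thesis using assms by (simp add: \<psi>_def smooth_retraction_def)
qed

text \<open>Both claims are proved together: tangency of \<open>d k\<close> places the next point in
  the carrier, and the transported direction is then tangent there.\<close>

lemma cg_iterates_tangent:
  fixes F :: "'p \<Rightarrow> 'b::euclidean_space"
  assumes g: "riemannian_metric A g" and F: "Ck_map 1 A euclidean_atlas F"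
    and C: "compact C" "C \<noteq> {}" and R: "smooth_retraction A R"
    and run: "cg_iterates A g F R C \<beta> t x d"
  shows "x k \<in> manifold_carrier A \<and> d k \<in> tangent_space A (x k)"
proof (induction k)
  case 0
  then show ?case using run descent_dir_minimizer(1)[OF g F C] by (simp add: cg_iterates_def)
next
  case (Suc k)
  have R': "smooth_map (tangent_bundle A) A R" using R by (simp add: smooth_retraction_def)
  have w: "tscale (t k) (d k) \<in> tangent_space A (x k)"
    using Suc tscale_in_tangent_space by blast
  have x: "x (Suc k) = R (x k, tscale (t k) (d k))"
    and d: "d (Suc k) = tadd (descent_dir A g F C (x (Suc k)))
      (tscale (\<beta> (Suc k)) (DR A R (x k) (tscale (t k) (d k)) (d k)))"
    using run by (auto simp: cg_iterates_def)
  have "x (Suc k) \<in> manifold_carrier A"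
    using bundle_map_in_carrier[OF R' _ w] Suc x by simp
  then show ?case
    using DR_in_tangent_space[OF R' _ w, of "d k"] Suc
      descent_dir_minimizer(1)[OF g F C, of "x (Suc k)"]
    by (simp add: d flip: x) (intro tadd_in_tangent_space tscale_in_tangent_space)
qed

end

section \<open>The Dai-Yuan estimate and the induction\<close>

lemma DF_conjugate_le:
  fixes F :: "'p \<Rightarrow> 'b::euclidean_space" and A :: "('p, 'e::euclidean_space) chart set"
  assumes "smooth_atlas A" "Ck_map 1 A euclidean_atlas F" "p \<in> manifold_carrier A"
    and C: "compact C" "C \<noteq> {}" and "r \<ge> 0"
  shows "\<phi> C (DF A F p (tadd u (tscale r w))) \<le> \<phi> C (DF A F p u) + r * \<phi> C (DF A F p w)"
proof -
  obtain c L where L: "linear L" "\<And>v. DF A F p v = L (v c)"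
    using DF_linear_coord[OF assms(1-3)] by blast
  have "DF A F p (tadd u (tscale r w)) = DF A F p u + r *\<^sub>R DF A F p w"
    by (simp add: L(2) tadd_def tscale_def linear_add[OF L(1)] linear_scale[OF L(1)])
  \<comment> \<open>Only nonnegative factors can be pulled out of \<open>\<phi>\<close>; here the
    lower bound on \<open>\<beta>\<close> enters.\<close>
  then show ?thesis
    using \<phi>_add[OF C, of "DF A F p u" "r *\<^sub>R DF A F p w"] \<phi>_scaleR_le[OF C \<open>r \<ge> 0\<close>, of "DF A F p w"]
    by simp
qed

text \<open>If \<open>s\<close> is positive, then \<open>s / (s - z) < 1\<close> because
  \<open>z\<close> is negative, so \<open>b * s\<close> stays below \<open>- v\<close>; otherwise
  \<open>b * s\<close> is not positive. Here \<open>z\<close> and \<open>s\<close> stand for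
  \<open>\<psi>\<close> at the start and at the end of a step, \<open>v\<close> for the slope along
  the new steepest descent direction.\<close>

lemma dai_yuan_negative:
  fixes v s z b :: real
  assumes "v < 0" "z < 0" "z < s" "0 \<le> b" "b \<le> - v / (s - z)"
  shows "v + b * s < 0"
proof (cases "s \<le> 0")
  case True
  with assms show ?thesis by (smt (verit) mult_nonneg_nonpos)
next
  case False
  have "b * s \<le> - v / (s - z) * s" using assms False by (intro mult_right_mono) auto
  also have "\<dots> < - v" using assms False by (simp add: field_simps mult_neg_neg)
  finally show ?thesis by simp
qed

theorem proposition4p6:
  fixes K C :: "(real ^ 'm) set" and e :: "real ^ 'm" and c1 c2 :: real
    and A :: "('p, real ^ 'n) chart set"
    and g :: "'p \<Rightarrow> ('p, real ^ 'n) tangent \<Rightarrow> ('p, real ^ 'n) tangent \<Rightarrow> real"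
    and F :: "'p \<Rightarrow> real ^ 'm"
    and R :: "'p \<times> ('p, real ^ 'n) tangent \<Rightarrow> 'p"
    and \<beta> t :: "nat \<Rightarrow> real" and x :: "nat \<Rightarrow> 'p" and d :: "nat \<Rightarrow> ('p, real ^ 'n) tangent"
  assumes K: "closed K" "convex K" "cone K" "K \<inter> uminus ` K = {0}" "interior K \<noteq> {}"
    and C: "compact C" "C \<subseteq> dual_cone K - {0}" "dual_cone K = cone hull (convex hull C)"
    and e: "e \<in> K" "\<forall>w\<in>C. 0 < w \<bullet> e \<and> w \<bullet> e \<le> 1"
    and c12: "0 < c1" "c1 < c2" "c2 < 1"
    and manifold: "smooth_manifold A" "riemannian_metric A g"
    and F: "Ck_map 1 A euclidean_atlas F"
    and R: "smooth_retraction A R"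
    and run: "cg_iterates A g F R C \<beta> t x d"
    and beta: "\<forall>k\<ge>1. 0 \<le> \<beta> k \<and> \<beta> k \<le> \<beta>_DY A g F R C t x d k"
    and wolfe: "\<forall>k. cone_le K (F (R (x k, tscale (t k) (d k))))
                  (F (x k) + (c1 * t k * \<phi> C (DF A F (x k) (d k))) *\<^sub>R e) \<and>
                \<psi> A F R C (x k) (d k) (t k) \<ge> c2 * \<psi> A F R C (x k) (d k) 0"
    and nonstop: "\<forall>k. descent_dir A g F C (x k) \<noteq> tzero"
  shows "(\<forall>k\<ge>1. DY_denominator A F R C t x d k \<noteq> 0) \<and>
    (\<forall>k. \<psi> A F R C (x k) (d k) 0 \<le> 0 \<and>
         \<psi> A F R C (x k) (d k) 0 \<le> \<psi> A F R C (x k) (d k) (t k))"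
proof -
  let ?\<psi>0 = "\<lambda>k. \<psi> A F R C (x k) (d k) 0" and ?\<psi>t = "\<lambda>k. \<psi> A F R C (x k) (d k) (t k)"
  let ?v = "\<lambda>k. descent_dir A g F C (x k)"
  have A: "smooth_atlas A" using manifold(1) by (simp add: smooth_manifold_def)
  have "0 \<in> dual_cone K" by (simp add: dual_cone_def)
  \<comment> \<open>The conic hull of the empty set is empty, whereas the dual cone contains
    0.\<close>
  then have Cne: "C \<noteq> {}" using C(3) by (metis cone_hull_contains_0 convex_hull_eq_empty)
  note xd = cg_iterates_tangent[OF A manifold(2) F C(1) Cne R run]
  have \<psi>0: "?\<psi>0 k = \<phi> C (DF A F (x k) (d k))" for k
    using \<psi>_at_0[OF A R] xd by blast
  have v0: "\<psi> A F R C (x k) (?v k) 0 = \<phi> C (DF A F (x k) (?v k))" for k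
    using \<psi>_at_0[OF A R] descent_dir_minimizer(1)[OF A manifold(2) F C(1) Cne] xd by blast
  have v_neg: "\<phi> C (DF A F (x k) (?v k)) < 0" for k
    using descent_dir_negative[OF A manifold(2) F C(1) Cne] xd nonstop by blast
  have increase: "?\<psi>0 k < ?\<psi>t k" if "?\<psi>0 k < 0" for k
  proof -
    \<comment> \<open>A factor \<open>c2 < 1\<close> strictly increases a negative number.\<close>
    have "?\<psi>0 k < c2 * ?\<psi>0 k" using that c12 by simp
    also have "\<dots> \<le> ?\<psi>t k" using wolfe by blast
    finally show ?thesis .
  qed
  \<comment> \<open>The strict sign is carried through the induction, since \<open>increase\<close>
    needs it to make the next denominator positive.\<close>
  have neg: "?\<psi>0 k < 0" for k
  proof (induction k)
    case 0
    have "d 0 = ?v 0" using run by (simp add: cg_iterates_def)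
    then show ?case using \<psi>0[of 0] v_neg[of 0] by simp
  next
    case (Suc k)
    let ?T = "DR A R (x k) (tscale (t k) (d k)) (d k)"
    have x: "x (Suc k) = R (x k, tscale (t k) (d k))"
      and d: "d (Suc k) = tadd (?v (Suc k)) (tscale (\<beta> (Suc k)) ?T)"
      using run by (auto simp: cg_iterates_def)
    have b: "0 \<le> \<beta> (Suc k)"
      "\<beta> (Suc k) \<le> - \<phi> C (DF A F (x (Suc k)) (?v (Suc k))) / (?\<psi>t k - ?\<psi>0 k)"
      using beta[rule_format, of "Suc k"] v0[of "Suc k"]
      by (simp_all add: \<beta>_DY_def DY_denominator_def)
    \<comment> \<open>The transported direction is exactly the vector at which \<psi> is evaluated
      at the end of the step, so its slope at the new point is a quantity from the Wolfe
      condition.\<close>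
    have "?\<psi>t k = \<phi> C (DF A F (x (Suc k)) ?T)" by (simp add: \<psi>_def x)
    then have "?\<psi>0 (Suc k) \<le> \<phi> C (DF A F (x (Suc k)) (?v (Suc k))) + \<beta> (Suc k) * ?\<psi>t k"
      using DF_conjugate_le[OF A F _ C(1) Cne b(1), of "x (Suc k)" "?v (Suc k)" ?T] xd[of "Suc k"]
      by (simp add: \<psi>0 flip: d)
    also have "\<dots> < 0"
      using dai_yuan_negative[OF v_neg Suc increase[OF Suc] b] .
    finally show ?case .
  qed
  \<comment> \<open>The denominator with index \<open>k\<close> belongs to the step
    \<open>k - 1\<close>, where \<open>increase\<close> makes it positive.\<close>
  show ?thesis
    using neg increase[OF neg] unfolding DY_denominator_def by (smt (verit))
qed

end
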